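(* Let $g\colon\mathbb{R}^n\to\mathbb{R}\cup\{\infty\}$ be a polyhedral convex function and let $h\colon\mathbb{R}^n\to\mathbb{R}\cup\{\infty\}$ be a closed convex function. Suppose that the problem $\min_{x\in\operatorname{dom} g}[g(x)-h(x)]$ has an optimal solution. Define $f\colon\mathbb{R}^n\times\mathbb{R}\to\mathbb{R}\cup\{-\infty\}$ by $f(x,r)=r-h(x)$, and put $P=\operatorname{epi} g$ and $C=0^+\operatorname{epi} g$. Then $C$ is a polyhedral convex cone and the following hold: (M) $f$ is $C$-monotone, i.e. for all $(x,r),(y,s)\in\mathbb{R}^n\times\mathbb{R}$, $(y,s)-(x,r)\in C$ implies $f(x,r)\le f(y,s)$; (B) $P$ is $C$-bounded, i.e. $0^+P\subseteq C$.
   Context: For $f\colon\mathbb{R}^n\to\mathbb{R}\cup\{\infty\}$, $\operatorname{dom} f=\{x\in\mathbb{R}^n\mid f(x)<\infty\}$ and $\operatorname{epi} f=\{(x,r)\in\mathbb{R}^n\times\mathbb{R}\mid r\ge f(x)\}$. A convex function is closed if its epigraph is a closed set, and polyhedral if its epigraph is a convex polyhedron (a finite intersection of closed half-spaces). The recession cone of a convex set $C$ is $0^+C=\{y\mid C+\{y\}\subseteq C\}$. For $x\in\operatorname{dom} g\setminus\operatorname{dom} h$ one has $g(x)-h(x)=-\infty$. An optimal solution of $\min_{x\in\operatorname{dom} g}[g(x)-h(x)]$ is a point $x^0\in\operatorname{dom} g$ such that $g(x^0)-h(x^0)$ is finite (i.e. $x^0\in\operatorname{dom} g\cap\operatorname{dom}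 h$) and $g(x^0)-h(x^0)\le g(x)-h(x)$ for all $x\in\operatorname{dom} g$. The associated concave minimization problem is to minimize $f(x,r)$ subject to $(x,r)\in\operatorname{epi} g$. *)

theory Defs
  imports "HOL-Analysis.Analysis"
begin

definition eff_dom :: "('a \<Rightarrow> ereal) \<Rightarrow> 'a set" where
  "eff_dom f = {x. f x < \<infinity>}"

(* The library's epigraph is for real-valued functions only. *)
definition epi :: "('a \<Rightarrow> ereal) \<Rightarrow> ('a \<times> real) set" where
  "epi f = {(x, r). f x \<le> ereal r}"

(* The conjunct excluding -\<infinity> restricts the codomain from ereal to the reals plus \<infinity>.
   The function constantly \<infinity> is allowed. *)
definition convex_fun :: "('a::real_vector \<Rightarrow> ereal) \<Rightarrow> bool" where
  "convex_fun f \<longleftrightarrow> (\<forall>x. f x \<noteq> -\<infinity>) \<and> convex (epi f)"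

definition closed_convex_fun :: "('a::real_normed_vector \<Rightarrow> ereal) \<Rightarrow> bool" where
  "closed_convex_fun f \<longleftrightarrow> convex_fun f \<and> closed (epi f)"

definition polyhedral_convex_fun :: "('a::euclidean_space \<Rightarrow> ereal) \<Rightarrow> bool" where
  "polyhedral_convex_fun f \<longleftrightarrow> convex_fun f \<and> polyhedron (epi f)"

definition recession_cone :: "'a::real_vector set \<Rightarrow> 'a set" where
  "recession_cone S = {y. (\<lambda>x. x + y) ` S \<subseteq> S}"

(* Optimality of x0 for minimizing g - h over the effective domain of g, with g and h never
   -\<infinity>. There g x is finite, so ereal subtraction gives g x - h x = -\<infinity> wherever h x = \<infinity>, and
   the undetermined difference of two infinities does not occur. *)
definition dc_optimal :: "('a \<Rightarrow> ereal) \<Rightarrow> ('a \<Rightarrow> ereal) \<Rightarrow> 'a \<Rightarrow> bool" where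
  "dc_optimal g h x0 \<longleftrightarrow> x0 \<in> eff_dom g \<and> \<bar>g x0 - h x0\<bar> \<noteq> \<infinity> \<and>
     (\<forall>x\<in>eff_dom g. g x0 - h x0 \<le> g x - h x)"

definition cone_monotone :: "'a::real_vector set \<Rightarrow> ('a \<Rightarrow> ereal) \<Rightarrow> bool" where
  "cone_monotone C f \<longleftrightarrow> (\<forall>u v. v - u \<in> C \<longrightarrow> f u \<le> f v)"

definition cone_bounded :: "'a::real_vector set \<Rightarrow> 'a set \<Rightarrow> bool" where
  "cone_bounded C P \<longleftrightarrow> recession_cone P \<subseteq> C"

end

theory Submission
  imports Defs
begin

text \<open>Let \<open>x0\<close> be optimal and \<open>(d, t) \<in> C\<close>. Since \<open>g (x0 + k d) \<le> g x0 + k t\<close>, optimality forces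
  \<open>h (x0 + k d) \<le> h x0 + k t\<close> for every natural \<open>k\<close>, so a ray of direction \<open>(d, t)\<close> lies in the
  closed convex set \<open>epi h\<close>. Hence \<open>(d, t)\<close> is a recession direction of \<open>epi h\<close>, that is
  \<open>h (x + d) \<le> h x + t\<close> for all \<open>x\<close>, which is the monotonicity of \<open>f\<close>.\<close>

lemma recession_coneD:
  assumes "y \<in> recession_cone S" "x \<in> S"
  shows "x + y \<in> S"
  using assms by (auto simp: recession_cone_def)

lemma recession_coneI:
  assumes "\<And>x. x \<in> S \<Longrightarrow> x + y \<in> S"
  shows "y \<in> recession_cone S"
  using assms by (auto simp: recession_cone_def)

lemma recession_cone_ray:
  assumes y: "y \<in> recession_cone S" and x: "x \<in> S"
  shows "x + real k *\<^sub>R y \<in> S"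
proof (induction k)
  case 0
  then show ?case using x by simp
next
  case (Suc k)
  then show ?case using recession_coneD[OF y Suc] by (simp add: algebra_simps)
qed

text \<open>A single ray suffices: this is what turns information along one ray from an optimal
  point into an inequality valid at every point.\<close>

lemma ray_imp_recession_cone:
  fixes S :: "'a::real_normed_vector set"
  assumes S: "closed S" "convex S"
    and ray: "\<And>k::nat. u + real k *\<^sub>R d \<in> S"
  shows "d \<in> recession_cone S"
proof (rule recession_coneI)
  fix x assume x: "x \<in> S"
  \<comment> \<open>A point on the segment from \<open>x\<close> to \<open>u + k d\<close>; it tends to \<open>x + d\<close>.\<close>
  define z where "z k = x + inverse (real (Suc k)) *\<^sub>R (u - x) + d" for k
  have "z k \<in> S" for k
  proof -
    \<comment> \<open>The weight \<open>1/(k+1)\<close> scales the displacement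
      \<open>(k+1) d\<close> back to exactly \<open>d\<close>; starting at \<open>Suc k\<close>
      avoids the weight \<open>inverse 0\<close>.\<close>
    let ?c = "inverse (real (Suc k))"
    have "(1 - ?c) *\<^sub>R x + ?c *\<^sub>R (u + real (Suc k) *\<^sub>R d) \<in> S"
      by (rule convexD_alt[OF S(2) x ray]) (auto simp: field_simps)
    moreover have "?c *\<^sub>R (real (Suc k) *\<^sub>R d) = d"
      by (simp del: of_nat_Suc)
    ultimately show ?thesis
      by (simp add: z_def algebra_simps del: of_nat_Suc)
  qed
  moreover have "z \<longlonglongrightarrow> x + 0 *\<^sub>R (u - x) + d"
    unfolding z_def by (intro tendsto_intros LIMSEQ_inverse_real_of_nat)
  ultimately show "x + d \<in> S"
    using closed_sequentially[OF S(1)] by force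
qed

text \<open>For the nontrivial inclusion, a ray from a common point \<open>u\<close> stays in the
  intersection, hence in each member, where one ray decides. For an empty intersection the left side
  would be the whole space.\<close>

lemma recession_cone_Inter:
  fixes F :: "'a::real_normed_vector set set"
  assumes F: "\<And>S. S \<in> F \<Longrightarrow> closed S \<and> convex S" and ne: "\<Inter>F \<noteq> {}"
  shows "recession_cone (\<Inter>F) = \<Inter>(recession_cone ` F)"
proof
  obtain u where u: "u \<in> \<Inter>F" using ne by blast
  show "recession_cone (\<Inter>F) \<subseteq> \<Inter>(recession_cone ` F)"
  proof (intro subsetI INT_I)
    fix y S assume y: "y \<in> recession_cone (\<Inter>F)" and S: "S \<in> F"
    have "u + real k *\<^sub>R y \<in> S" for k
      using recession_cone_ray[OF y u] S by blast
    then show "y \<in> recession_cone S"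
      using F[OF S] by (blast intro: ray_imp_recession_cone)
  qed
  show "\<Inter>(recession_cone ` F) \<subseteq> recession_cone (\<Inter>F)"
    by (auto intro!: recession_coneI dest: recession_coneD)
qed

lemma recession_cone_halfspace_le:
  fixes a :: "'a::real_inner"
  assumes "a \<noteq> 0"
  shows "recession_cone {x. a \<bullet> x \<le> b} = {y. a \<bullet> y \<le> 0}"
proof
  show "recession_cone {x. a \<bullet> x \<le> b} \<subseteq> {y. a \<bullet> y \<le> 0}"
  proof
    fix y assume y: "y \<in> recession_cone {x. a \<bullet> x \<le> b}"
    \<comment> \<open>This multiple of \<open>a\<close> lies on the bounding hyperplane, so its
      translate by \<open>y\<close> stays in the half-space only if
      \<open>a \<bullet> y \<le> 0\<close>.\<close>
    have "a \<bullet> ((b / (a \<bullet> a)) *\<^sub>R a) = b" using assms by simp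
    with recession_coneD[OF y, of "(b / (a \<bullet> a)) *\<^sub>R a"] show "y \<in> {y. a \<bullet> y \<le> 0}"
      by (simp add: inner_add_right)
  qed
  show "{y. a \<bullet> y \<le> 0} \<subseteq> recession_cone {x. a \<bullet> x \<le> b}"
    by (auto intro!: recession_coneI simp: inner_add_right)
qed

text \<open>The recession cone is cut out by the same finitely many half-spaces with their
  right-hand sides replaced by \<open>0\<close>.\<close>

lemma recession_cone_polyhedron:
  fixes S :: "'a::euclidean_space set"
  assumes "polyhedron S" "S \<noteq> {}"
  shows "polyhedron (recession_cone S) \<and> convex_cone (recession_cone S)"
proof -
  obtain F where fin: "finite F" and S: "S = \<Inter>F"
    and F: "\<forall>H\<in>F. \<exists>a b. a \<noteq> 0 \<and> H = {x. a \<bullet> x \<le> b}"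
    using assms(1) unfolding polyhedron_def by blast
  have eq: "recession_cone S = \<Inter>(recession_cone ` F)"
    unfolding S using F assms(2) S
    by (intro recession_cone_Inter) (auto simp: closed_halfspace_le convex_halfspace_le)
  have "polyhedron (recession_cone H) \<and> convex_cone (recession_cone H)" if H: "H \<in> F" for H
  proof -
    obtain a b where "a \<noteq> 0" "H = {x. a \<bullet> x \<le> b}" using F H by blast
    then show ?thesis
      by (simp add: recession_cone_halfspace_le polyhedron_halfspace_le convex_cone_halfspace_le)
  qed
  then show ?thesis
    unfolding eq using fin by (auto intro!: polyhedron_Inter convex_cone_Inter)
qed

lemma dc_optimal_imp_recession_cone_subset:
  fixes g h :: "'a::real_normed_vector \<Rightarrow> ereal"
  assumes g: "\<And>x. g x \<noteq> -\<infinity>" and h: "closed_convex_fun h" and opt: "dc_optimal g h x0"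
  shows "recession_cone (epi g) \<subseteq> recession_cone (epi h)"
proof
  fix w assume w: "w \<in> recession_cone (epi g)"
  obtain d t where wdt: "w = (d, t)" by fastforce
  have hinf: "h x \<noteq> -\<infinity>" for x
    using h by (auto simp: closed_convex_fun_def convex_fun_def)
  have x0: "g x0 < \<infinity>" "\<bar>g x0 - h x0\<bar> \<noteq> \<infinity>"
    and min: "\<And>x. g x < \<infinity> \<Longrightarrow> g x0 - h x0 \<le> g x - h x"
    using opt by (auto simp: dc_optimal_def eff_dom_def)
  obtain a where a: "g x0 = ereal a" using g[of x0] x0(1) by (cases "g x0") auto
  obtain b where b: "h x0 = ereal b" using hinf[of x0] x0(2) a by (cases "h x0") auto
  have "(x0, b) + real k *\<^sub>R w \<in> epi h" for k
  proof -
    have "(x0, a) + real k *\<^sub>R w \<in> epi g"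
      by (rule recession_cone_ray[OF w]) (simp add: epi_def a)
    then have le: "g (x0 + real k *\<^sub>R d) \<le> ereal (a + real k * t)"
      by (simp add: epi_def wdt)
    then obtain c where c: "g (x0 + real k *\<^sub>R d) = ereal c"
      using g[of "x0 + real k *\<^sub>R d"] by (cases "g (x0 + real k *\<^sub>R d)") auto
    have "ereal a - ereal b \<le> ereal c - h (x0 + real k *\<^sub>R d)"
      using min[of "x0 + real k *\<^sub>R d"] by (simp add: a b c)
    \<comment> \<open>The value of \<open>h\<close> here cannot be \<infinity>, since the right side
      above would be -\<infinity>. Rearranging gives \<open>h (x0 + k d) \<le> b + c - a\<close>,
      and \<open>c \<le> a + k t\<close>.\<close>
    then have "h (x0 + real k *\<^sub>R d) \<le> ereal (b + real k * t)"
      using le c by (cases "h (x0 + real k *\<^sub>R d)") auto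
    then show ?thesis by (simp add: epi_def wdt)
  qed
  then show "w \<in> recession_cone (epi h)"
    using h by (intro ray_imp_recession_cone) (auto simp: closed_convex_fun_def convex_fun_def)
qed

text \<open>Translating the graph point \<open>(x, h x)\<close> by \<open>(y - x, s - r)\<close>
  gives \<open>h y \<le> h x + s - r\<close>. If \<open>h x = \<infinity>\<close>, the left side of
  the claim is -\<infinity>.\<close>

lemma cone_monotone_recession_cone_epi:
  fixes h :: "'a::real_vector \<Rightarrow> ereal"
  assumes h: "\<And>x. h x \<noteq> -\<infinity>" and C: "C \<subseteq> recession_cone (epi h)"
  shows "cone_monotone C (\<lambda>(x, r). ereal r - h x)"
  unfolding cone_monotone_def
proof clarify
  fix x y :: 'a and r s :: real
  assume yx: "(y, s) - (x, r) \<in> C"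
  show "ereal r - h x \<le> ereal s - h y"
  proof (cases "h x")
    case (real c)
    have "(x, c) + ((y, s) - (x, r)) \<in> epi h"
      using yx C real by (intro recession_coneD) (auto simp: epi_def)
    then have "h y \<le> ereal (c + s - r)" by (simp add: epi_def algebra_simps)
    then show ?thesis using real h[of y] by (cases "h y") auto
  qed (use h[of x] in auto)
qed

theorem theorem13:
  fixes g h :: "real ^ 'n \<Rightarrow> ereal"
    and f :: "(real ^ 'n) \<times> real \<Rightarrow> ereal"
    and P C :: "((real ^ 'n) \<times> real) set"
  assumes "polyhedral_convex_fun g"
    and "closed_convex_fun h"
    and "\<exists>x0. dc_optimal g h x0"
    and "f = (\<lambda>(x, r). ereal r - h x)"
    and "P = epi g"
    and "C = recession_cone (epi g)"
  shows "polyhedron C \<and> convex_cone C \<and> cone_monotone C f \<and> cone_bounded C P"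
proof -
  obtain x0 where x0: "dc_optimal g h x0" using assms(3) by blast
  have ginf: "g x \<noteq> -\<infinity>" for x
    using assms(1) by (auto simp: polyhedral_convex_fun_def convex_fun_def)
  have hinf: "h x \<noteq> -\<infinity>" for x
    using assms(2) by (auto simp: closed_convex_fun_def convex_fun_def)
  \<comment> \<open>Finiteness at the optimal point makes \<open>epi g\<close> nonempty, as the
    polyhedrality of its recession cone requires.\<close>
  have "g x0 < \<infinity>" using x0 by (simp add: dc_optimal_def eff_dom_def)
  then obtain a where "g x0 = ereal a" using ginf[of x0] by (cases "g x0") auto
  then have "(x0, a) \<in> epi g" by (simp add: epi_def)
  then have "polyhedron C \<and> convex_cone C"
    using assms(1) recession_cone_polyhedron[of "epi g"]
    by (auto simp: polyhedral_convex_fun_def assms(6))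
  moreover have "cone_monotone C f"
    unfolding assms(4,6) using hinf ginf assms(2) x0
    by (intro cone_monotone_recession_cone_epi dc_optimal_imp_recession_cone_subset)
  \<comment> \<open>Boundedness holds with equality, as \<open>C\<close> is the recession cone of
    \<open>P\<close> itself.\<close>
  ultimately show ?thesis
    by (simp add: cone_bounded_def assms(5,6))
qed

end
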